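(* Let $p$ be a prime number, let $1 \leq e_1 \leq \cdots \leq e_n$ be integers, and let $H_p = \mathbb{Z}/p^{e_1}\mathbb{Z} \times \cdots \times \mathbb{Z}/p^{e_n}\mathbb{Z}$. Then the map $\psi: R_p \to \mathrm{End}(H_p)$ given by \[\psi(A)(\overline{h}_1,\ldots,\overline{h}_n)^T = \pi\left(A(h_1,\ldots,h_n)^T\right)\] (where $h_i \in \mathbb{Z}$ is any integer representative of $\overline{h}_i \in \mathbb{Z}/p^{e_i}\mathbb{Z}$) is a (well-defined) surjective ring homomorphism.
   Context: $R_p$ is the set of integer matrices \[R_p = \left\{ (a_{ij}) \in \mathbb{Z}^{n \times n} : p^{e_i-e_j} \mid a_{ij} \text{ for all } i,j \text{ satisfying } 1 \leq j \leq i \leq n\right\},\] which is a ring under the usual matrix addition and multiplication, with identity the $n\times n$ identity matrix $I$. Elements of $H_p$ are written as column vectors $(\overline{h}_1,\ldots,\overline{h}_n)^T$ with $\overline{h}_i \in \mathbb{Z}/p^{e_i}\mathbb{Z}$. The map $\pi: \mathbb{Z}^n \to H_p$ is the group homomorphism $\pi(h_1,\ldots,h_n)^T = (\overline{h}_1,\ldots,\overline{h}_n)^T$, where $\overline{h}_i$ is the class of $h_i$ modulo $p^{e_i}$. $\mathrm{End}(H_p)$ is the ring of group endomorphisms of $H_p$, with pointwise addition $(A+B)(h) = A(h)+B(h)$ and with multiplication given by composition; ring homomorphisms are unital. *)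

theory Defs
  imports
    "HOL-Algebra.Product_Groups"
    "HOL-Algebra.RingHom"
    "HOL-Computational_Algebra.Primes"
    "Jordan_Normal_Form.Matrix"
begin

text \<open>
  Rows, columns and exponents are indexed by \<open>0, \<dots>, n - 1\<close>, as is usual for
  \<^typ>\<open>int mat\<close> and \<^typ>\<open>int vec\<close>; thus \<open>e i\<close> is the \<open>(i + 1)\<close>-st exponent.
  The group \<^term>\<open>integer_mod_group m\<close> represents each class modulo \<open>m > 0\<close> by its residue in
  \<open>{0..<m}\<close>.
\<close>

definition Hp :: "nat \<Rightarrow> nat \<Rightarrow> (nat \<Rightarrow> nat) \<Rightarrow> (nat \<Rightarrow> int) monoid" where
  "Hp p n e = product_group {..<n} (\<lambda>i. integer_mod_group (p ^ e i))"

definition class_map :: "nat \<Rightarrow> nat \<Rightarrow> (nat \<Rightarrow> nat) \<Rightarrow> int vec \<Rightarrow> (nat \<Rightarrow> int)" where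
  "class_map p n e h = (\<lambda>i\<in>{..<n}. h $ i mod int (p ^ e i))"

text \<open>
  The truncated subtraction \<open>e i - e j\<close> below is the true difference, because it is only used for
  \<open>j \<le> i\<close> and \<open>e\<close> will always be nondecreasing.
\<close>

definition Rp :: "nat \<Rightarrow> nat \<Rightarrow> (nat \<Rightarrow> nat) \<Rightarrow> int mat ring" where
  "Rp p n e = (ring_mat TYPE(int) n ())
     \<lparr>carrier := {A \<in> carrier_mat n n.
        \<forall>i<n. \<forall>j\<le>i. int (p ^ (e i - e j)) dvd A $$ (i, j)}\<rparr>"

text \<open>
  Endomorphisms are taken to be \<^const>\<open>extensional\<close>, i.e. \<^const>\<open>undefined\<close> outside the carrier,
  so that equality in the carrier of the endomorphism ring is equality of maps on the group.
\<close>

definition End_ring :: "('a, 'b) monoid_scheme \<Rightarrow> ('a \<Rightarrow> 'a) ring" where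
  "End_ring G =
     \<lparr>carrier = hom G G \<inter> extensional (carrier G),
      monoid.mult = compose (carrier G),
      one = (\<lambda>x\<in>carrier G. x),
      zero = (\<lambda>x\<in>carrier G. \<one>\<^bsub>G\<^esub>),
      add = (\<lambda>f g. \<lambda>x\<in>carrier G. f x \<otimes>\<^bsub>G\<^esub> g x)\<rparr>"

text \<open>
  The integer representative is picked arbitrarily; that the result does not depend on it is
  part of what has to be proved about \<open>psi\<close>.
\<close>

definition psi :: "nat \<Rightarrow> nat \<Rightarrow> (nat \<Rightarrow> nat) \<Rightarrow> int mat \<Rightarrow> (nat \<Rightarrow> int) \<Rightarrow> (nat \<Rightarrow> int)" where
  "psi p n e A = (\<lambda>x\<in>carrier (Hp p n e).
     class_map p n e (A *\<^sub>v (SOME h. h \<in> carrier_vec n \<and> class_map p n e h = x)))"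

end

theory Submission
  imports Defs "HOL-Algebra.Subrings"
begin

text \<open>
  For \<open>A\<close> in \<open>R\<^sub>p\<close> the integer \<open>p^(e j) * A i j\<close> is divisible by \<open>p^(e i)\<close> for all
  \<open>i, j\<close>, which says exactly that \<open>A\<close> maps the kernel of \<open>\<pi>\<close> into itself.  Conversely, an
  endomorphism \<open>f\<close> of \<open>H\<^sub>p\<close> is determined by its values on the classes of the unit vectors, and
  lifting these values to integer columns gives a matrix \<open>A\<close>.  Since the class of \<open>p^(e j)\<close> times
  the \<open>j\<close>-th unit vector is trivial, \<open>p^(e i)\<close> divides \<open>p^(e j) * A i j\<close>, so that \<open>A\<close> lies in
  \<open>R\<^sub>p\<close>.
\<close>

section \<open>The endomorphism ring of a commutative group\<close>

text \<open>Commutativity makes pointwise sums and pointwise inverses of endomorphisms homomorphisms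
  again. The ring identities can be checked pointwise because \<open>extensional\<close> maps that
  agree on the carrier are equal.\<close>

lemma ring_End_ring:
  fixes G (structure)
  assumes "comm_group G"
  shows "ring (End_ring G)"
proof -
  interpret comm_group G by fact
  let ?E = "End_ring G"
  have closed: "f x \<in> carrier G" if "f \<in> carrier ?E" "x \<in> carrier G" for f x
    using that by (auto simp: End_ring_def hom_def)
  have mult: "f (x \<otimes> y) = f x \<otimes> f y" if "f \<in> carrier ?E" "x \<in> carrier G" "y \<in> carrier G" for f x y
    using that by (auto simp: End_ring_def hom_def)
  have one: "f \<one> = \<one>" if "f \<in> carrier ?E" for f
    using that by (intro hom_one[of f G]) (auto simp: End_ring_def)
  have homI: "f \<in> carrier ?E"
    if "\<And>x. x \<in> carrier G \<Longrightarrow> f x \<in> carrier G"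
      "\<And>x y. x \<in> carrier G \<Longrightarrow> y \<in> carrier G \<Longrightarrow> f (x \<otimes> y) = f x \<otimes> f y"
      "f \<in> extensional (carrier G)" for f
    using that by (simp add: End_ring_def hom_def)
  have eqI: "f = g"
    if "f \<in> carrier ?E" "g \<in> carrier ?E" "\<And>x. x \<in> carrier G \<Longrightarrow> f x = g x" for f g
    using that by (intro extensionalityI[of f "carrier G" g]) (simp_all add: End_ring_def)
  have apply_ops: "(f \<otimes>\<^bsub>?E\<^esub> g) x = f (g x)" "(f \<oplus>\<^bsub>?E\<^esub> g) x = f x \<otimes> g x"
    "\<one>\<^bsub>?E\<^esub> x = x" "\<zero>\<^bsub>?E\<^esub> x = \<one>" if "x \<in> carrier G" for f g x
    using that by (simp_all add: End_ring_def compose_def)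
  have ext: "f \<otimes>\<^bsub>?E\<^esub> g \<in> extensional (carrier G)" "f \<oplus>\<^bsub>?E\<^esub> g \<in> extensional (carrier G)"
    "\<one>\<^bsub>?E\<^esub> \<in> extensional (carrier G)" "\<zero>\<^bsub>?E\<^esub> \<in> extensional (carrier G)" for f g
    by (simp_all add: End_ring_def)
  have ops_closed: "f \<otimes>\<^bsub>?E\<^esub> g \<in> carrier ?E" "f \<oplus>\<^bsub>?E\<^esub> g \<in> carrier ?E"
    if "f \<in> carrier ?E" "g \<in> carrier ?E" for f g
    using that by (auto intro!: homI simp: ext apply_ops closed mult m_ac)
  have units_closed: "\<one>\<^bsub>?E\<^esub> \<in> carrier ?E" "\<zero>\<^bsub>?E\<^esub> \<in> carrier ?E"
    by (auto intro!: homI simp: ext apply_ops)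
  note [simp] = ops_closed units_closed apply_ops closed mult one
  show ?thesis
  proof (intro ringI abelian_groupI monoidI)
    fix f assume f: "f \<in> carrier ?E"
    have inv_closed: "(\<lambda>x\<in>carrier G. inv f x) \<in> carrier ?E"
      using f by (auto intro!: homI simp: inv_mult)
    show "\<exists>g\<in>carrier ?E. g \<oplus>\<^bsub>?E\<^esub> f = \<zero>\<^bsub>?E\<^esub>"
      using f inv_closed by (intro bexI[OF _ inv_closed] eqI) auto
  qed ((simp; fail) | (rule eqI; simp add: m_ac))+
qed

section \<open>Additive maps modulo an integer\<close>

text \<open>
  Only congruences are used, so that the lemma applies to an endomorphism of \<open>H\<^sub>p\<close> read off at one
  coordinate and precomposed with \<open>\<pi>\<close>.
\<close>

lemma additive_mod_unit_vec:
  fixes \<phi> :: "int vec \<Rightarrow> int"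
  assumes add: "\<And>h h'. h \<in> carrier_vec n \<Longrightarrow> h' \<in> carrier_vec n \<Longrightarrow> m dvd \<phi> (h + h') - (\<phi> h + \<phi> h')"
    and h: "h \<in> carrier_vec n"
  shows "m dvd \<phi> h - (\<Sum>j<n. \<phi> (unit_vec n j) * h $ j)"
proof -
  \<comment> \<open>Additivity at 0 + 0 gives that \<open>m\<close> divides
    \<open>\<phi> 0 - 2 * \<phi> 0\<close>, which is \<open>- \<phi> 0\<close>.\<close>
  have zero: "m dvd \<phi> (0\<^sub>v n)"
    using add[of "0\<^sub>v n" "0\<^sub>v n"] by simp
  have nat: "m dvd \<phi> (int k \<cdot>\<^sub>v u) - int k * \<phi> u" if u: "u \<in> carrier_vec n" for k u
  proof (induction k)
    case 0
    have "int 0 \<cdot>\<^sub>v u = 0\<^sub>v n" using u by auto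
    with zero show ?case by simp
  next
    case (Suc k)
    have "int (Suc k) \<cdot>\<^sub>v u = int k \<cdot>\<^sub>v u + u"
      using u by (auto simp: algebra_simps)
    moreover have "m dvd \<phi> (int k \<cdot>\<^sub>v u + u) - (\<phi> (int k \<cdot>\<^sub>v u) + \<phi> u)"
      using add u by simp
    ultimately show ?case
      using dvd_add[OF Suc] by (fastforce simp: algebra_simps)
  qed
  have smult: "m dvd \<phi> (c \<cdot>\<^sub>v u) - c * \<phi> u" if u: "u \<in> carrier_vec n" for c u
  proof (cases "0 \<le> c")
    case True
    then show ?thesis using nat[OF u, of "nat c"] by simp
  next
    case False
    \<comment> \<open>For negative \<open>c\<close> the natural multiple \<open>- c\<close> is
      already covered. Additivity relates it to \<open>c\<close> because the two multiples add up to
      zero, where \<open>\<phi>\<close> is 0 modulo \<open>m\<close>.\<close>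
    have "c \<cdot>\<^sub>v u + (- c) \<cdot>\<^sub>v u = 0\<^sub>v n" using u by auto
    then have "m dvd \<phi> (0\<^sub>v n) - (\<phi> (c \<cdot>\<^sub>v u) + \<phi> ((- c) \<cdot>\<^sub>v u))"
      using add[of "c \<cdot>\<^sub>v u" "(- c) \<cdot>\<^sub>v u"] u by simp
    moreover have "m dvd \<phi> ((- c) \<cdot>\<^sub>v u) - (- c) * \<phi> u"
      using False nat[OF u, of "nat (- c)"] by simp
    ultimately have "m dvd \<phi> (0\<^sub>v n) - (\<phi> (0\<^sub>v n) - (\<phi> (c \<cdot>\<^sub>v u) + \<phi> ((- c) \<cdot>\<^sub>v u)))
        - (\<phi> ((- c) \<cdot>\<^sub>v u) - (- c) * \<phi> u)"
      using zero dvd_diff by blast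
    then show ?thesis by simp
  qed
  \<comment> \<open>\<open>trunc k\<close> keeps the first \<open>k\<close> entries of
    \<open>h\<close>, so the sum is built up one coordinate at a time, from the zero vector at
    \<open>k = 0\<close> to \<open>h\<close> itself at \<open>k = n\<close>.\<close>
  define trunc where "trunc k = vec n (\<lambda>j. if j < k then h $ j else 0)" for k
  have "m dvd \<phi> (trunc k) - (\<Sum>j<k. \<phi> (unit_vec n j) * h $ j)" if "k \<le> n" for k
    using that
  proof (induction k)
    case 0
    have "trunc 0 = 0\<^sub>v n" by (auto simp: trunc_def)
    with zero show ?case by simp
  next
    case (Suc k)
    have "trunc (Suc k) = trunc k + h $ k \<cdot>\<^sub>v unit_vec n k"
      using Suc.prems by (intro eq_vecI) (auto simp: trunc_def less_Suc_eq)
    then have "m dvd \<phi> (trunc (Suc k)) - (\<phi> (trunc k) + \<phi> (h $ k \<cdot>\<^sub>v unit_vec n k))"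
      using add[of "trunc k" "h $ k \<cdot>\<^sub>v unit_vec n k"] by (simp add: trunc_def)
    moreover have "m dvd \<phi> (h $ k \<cdot>\<^sub>v unit_vec n k) - h $ k * \<phi> (unit_vec n k)"
      by (rule smult) simp
    moreover have "m dvd \<phi> (trunc k) - (\<Sum>j<k. \<phi> (unit_vec n j) * h $ j)"
      using Suc by simp
    ultimately have "m dvd (\<phi> (trunc (Suc k)) - (\<phi> (trunc k) + \<phi> (h $ k \<cdot>\<^sub>v unit_vec n k)))
        + (\<phi> (h $ k \<cdot>\<^sub>v unit_vec n k) - h $ k * \<phi> (unit_vec n k))
        + (\<phi> (trunc k) - (\<Sum>j<k. \<phi> (unit_vec n j) * h $ j))"
      by (intro dvd_add)
    then show ?case by (simp add: algebra_simps)
  qed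
  from this[of n] have "m dvd \<phi> (trunc n) - (\<Sum>j<n. \<phi> (unit_vec n j) * h $ j)"
    by simp
  moreover have "trunc n = h" using h by (auto simp: trunc_def)
  ultimately show ?thesis by simp
qed

lemma mat_vec_index_sum:
  assumes "A \<in> carrier_mat n n" "h \<in> carrier_vec n" "i < n"
  shows "(A *\<^sub>v h) $ i = (\<Sum>j<n. A $$ (i, j) * h $ j)"
  using assms by (auto simp: scalar_prod_def atLeast0LessThan intro!: sum.cong)

section \<open>The group \<open>Hp\<close> and the class map\<close>

locale exponents =
  fixes p n :: nat and e :: "nat \<Rightarrow> nat"
  assumes p_pos: "0 < p"
    and e_mono: "\<And>i j. i \<le> j \<Longrightarrow> j < n \<Longrightarrow> e i \<le> e j"
begin

lemma carrier_Hp: "carrier (Hp p n e) = (\<Pi>\<^sub>E i\<in>{..<n}. {0..<int (p ^ e i)})"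
  using p_pos by (auto simp: Hp_def carrier_integer_mod_group intro!: PiE_cong)

lemma mult_Hp: "x \<otimes>\<^bsub>Hp p n e\<^esub> y = (\<lambda>i\<in>{..<n}. (x i + y i) mod int (p ^ e i))"
  by (simp add: Hp_def)

lemma comm_group_Hp: "comm_group (Hp p n e)"
proof (rule group.group_comm_groupI)
  show "Group.group (Hp p n e)"
    by (simp add: Hp_def)
qed (auto simp: mult_Hp add.commute)

lemma class_map_closed: "class_map p n e h \<in> carrier (Hp p n e)"
  using p_pos by (auto simp: carrier_Hp class_map_def)

lemma class_map_add:
  assumes "h \<in> carrier_vec n" "h' \<in> carrier_vec n"
  shows "class_map p n e (h + h') = class_map p n e h \<otimes>\<^bsub>Hp p n e\<^esub> class_map p n e h'"
  using assms by (auto simp: mult_Hp class_map_def mod_add_eq intro!: restrict_ext)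

lemma class_map_eq_iff:
  "class_map p n e h = class_map p n e h' \<longleftrightarrow> (\<forall>i<n. int (p ^ e i) dvd h $ i - h' $ i)"
  unfolding class_map_def by (simp add: fun_eq_iff restrict_def mod_eq_dvd_iff)

lemma class_map_surj:
  assumes "x \<in> carrier (Hp p n e)"
  obtains h where "h \<in> carrier_vec n" "class_map p n e h = x"
proof
  show "vec n x \<in> carrier_vec n" by simp
  show "class_map p n e (vec n x) = x"
    using assms by (auto simp: carrier_Hp class_map_def PiE_iff extensional_def fun_eq_iff)
qed

section \<open>The ring \<open>Rp\<close>\<close>

text \<open>
  For \<open>i < j\<close> the truncated difference \<open>e i - e j\<close> vanishes, so the divisibility condition may be
  imposed on all entries.
\<close>

lemma carrier_Rp:
  "A \<in> carrier (Rp p n e) \<longleftrightarrow>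
    A \<in> carrier_mat n n \<and> (\<forall>i<n. \<forall>j<n. int (p ^ (e i - e j)) dvd A $$ (i, j))"
proof -
  have "int (p ^ (e i - e j)) dvd A $$ (i, j)" if "\<not> j \<le> i" "j < n" for i j
    using e_mono[of i j] that by simp
  then show ?thesis
    unfolding Rp_def by (auto simp: not_le) (meson leI)
qed

text \<open>The ring axioms are inherited from the full matrix ring, so only closure has to be
  checked.\<close>

lemma ring_Rp: "ring (Rp p n e)"
proof -
  interpret M: ring "ring_mat TYPE(int) n ()" by (rule ring_mat)
  have "subring (carrier (Rp p n e)) (ring_mat TYPE(int) n ())"
  proof (rule M.subringI)
    show "\<one>\<^bsub>ring_mat TYPE(int) n ()\<^esub> \<in> carrier (Rp p n e)"
      by (auto simp: carrier_Rp ring_mat_simps)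
  next
    fix A assume A: "A \<in> carrier (Rp p n e)"
    then have "\<ominus>\<^bsub>ring_mat TYPE(int) n ()\<^esub> A = - A"
      by (intro M.minus_equality) (auto simp: carrier_Rp ring_mat_simps)
    with A show "\<ominus>\<^bsub>ring_mat TYPE(int) n ()\<^esub> A \<in> carrier (Rp p n e)"
      by (auto simp: carrier_Rp)
  next
    fix A B assume A: "A \<in> carrier (Rp p n e)" and B: "B \<in> carrier (Rp p n e)"
    have "int (p ^ (e i - e j)) dvd A $$ (i, k) * B $$ (k, j)" if "i < n" "j < n" "k < n" for i j k
    proof -
      \<comment> \<open>The exponents satisfy
        \<open>e i - e j \<le> (e i - e k) + (e k - e j)\<close>, also with truncated subtraction
        and for every order of the three indices.\<close>
      have "int (p ^ (e i - e j)) dvd int (p ^ (e i - e k)) * int (p ^ (e k - e j))"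
        by (simp flip: power_add add: le_imp_power_dvd)
      also have "\<dots> dvd A $$ (i, k) * B $$ (k, j)"
        using A B that unfolding carrier_Rp by (intro mult_dvd_mono) auto
      finally show ?thesis .
    qed
    with A B show "A \<otimes>\<^bsub>ring_mat TYPE(int) n ()\<^esub> B \<in> carrier (Rp p n e)"
      by (auto simp: carrier_Rp ring_mat_simps scalar_prod_def intro!: dvd_sum)
  next
    fix A B assume "A \<in> carrier (Rp p n e)" "B \<in> carrier (Rp p n e)"
    then show "A \<oplus>\<^bsub>ring_mat TYPE(int) n ()\<^esub> B \<in> carrier (Rp p n e)"
      by (auto simp: carrier_Rp ring_mat_simps)
  qed (auto simp: carrier_Rp ring_mat_simps)
  then have "ring (ring_mat TYPE(int) n () \<lparr>carrier := carrier (Rp p n e)\<rparr>)"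
    by (rule M.subring_is_ring)
  then show ?thesis by (simp add: Rp_def)
qed

section \<open>Well-definedness and the homomorphism property\<close>

text \<open>In each term of row \<open>i\<close>, the matrix entry supplies the factor
  \<open>p ^ (e i - e j)\<close> and the difference of the two representatives supplies
  \<open>p ^ e j\<close>. Together they reach the exponent \<open>e i\<close>.\<close>

lemma class_map_mult_mat_vec_cong:
  assumes A: "A \<in> carrier (Rp p n e)"
    and h: "h \<in> carrier_vec n" "h' \<in> carrier_vec n" "class_map p n e h = class_map p n e h'"
  shows "class_map p n e (A *\<^sub>v h) = class_map p n e (A *\<^sub>v h')"
  unfolding class_map_eq_iff
proof (intro allI impI)
  fix i assume i: "i < n"
  have "int (p ^ e i) dvd A $$ (i, j) * (h $ j - h' $ j)" if "j < n" for j
  proof -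
    have "int (p ^ e i) dvd int (p ^ (e i - e j)) * int (p ^ e j)"
      by (simp flip: power_add add: le_imp_power_dvd)
    also have "\<dots> dvd A $$ (i, j) * (h $ j - h' $ j)"
      using A h(3) i that by (intro mult_dvd_mono) (auto simp: carrier_Rp class_map_eq_iff)
    finally show ?thesis .
  qed
  then have "int (p ^ e i) dvd (\<Sum>j<n. A $$ (i, j) * (h $ j - h' $ j))"
    by (intro dvd_sum) auto
  also have "(\<Sum>j<n. A $$ (i, j) * (h $ j - h' $ j)) = (A *\<^sub>v h) $ i - (A *\<^sub>v h') $ i"
    using mat_vec_index_sum[OF _ h(1) i, of A] mat_vec_index_sum[OF _ h(2) i, of A] A
    by (simp add: carrier_Rp right_diff_distrib sum_subtractf del: index_mult_mat_vec)
  finally show "int (p ^ e i) dvd (A *\<^sub>v h) $ i - (A *\<^sub>v h') $ i" .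
qed

text \<open>The vector picked by \<open>SOME\<close> may differ from \<open>h\<close> but has the
  same class, so the congruence just proved applies. From here on \<open>psi\<close> can be computed
  with any representative.\<close>

lemma psi_class_map:
  assumes A: "A \<in> carrier (Rp p n e)" and h: "h \<in> carrier_vec n"
  shows "psi p n e A (class_map p n e h) = class_map p n e (A *\<^sub>v h)"
proof -
  let ?h = "SOME h'. h' \<in> carrier_vec n \<and> class_map p n e h' = class_map p n e h"
  have "?h \<in> carrier_vec n \<and> class_map p n e ?h = class_map p n e h"
    by (rule someI[of _ h]) (use h in simp)
  then have "class_map p n e (A *\<^sub>v ?h) = class_map p n e (A *\<^sub>v h)"
    using A h by (intro class_map_mult_mat_vec_cong) auto
  then show ?thesis by (simp add: psi_def class_map_closed)
qed

lemma psi_extensional: "psi p n e A \<in> extensional (carrier (Hp p n e))"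
  by (simp add: psi_def)

text \<open>Every element of the group is the class of an integer vector, so a map is recognised as
  \<open>psi p n e A\<close> by its values on classes. This serves both the homomorphism laws and
  surjectivity.\<close>

lemma eq_psiI:
  assumes "A \<in> carrier (Rp p n e)" "f \<in> extensional (carrier (Hp p n e))"
    and "\<And>h. h \<in> carrier_vec n \<Longrightarrow> f (class_map p n e h) = class_map p n e (A *\<^sub>v h)"
  shows "psi p n e A = f"
proof (rule extensionalityI[OF psi_extensional assms(2)])
  fix x assume "x \<in> carrier (Hp p n e)"
  then show "psi p n e A x = f x"
    using assms psi_class_map by (metis class_map_surj)
qed

lemma psi_closed:
  assumes A: "A \<in> carrier (Rp p n e)"
  shows "psi p n e A \<in> carrier (End_ring (Hp p n e))"
proof -
  have Ac: "A \<in> carrier_mat n n" using A by (simp add: carrier_Rp)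
  have "psi p n e A \<in> hom (Hp p n e) (Hp p n e)"
  proof (rule homI)
    fix x assume "x \<in> carrier (Hp p n e)"
    then show "psi p n e A x \<in> carrier (Hp p n e)"
      by (simp add: psi_def class_map_closed)
  next
    fix x y assume "x \<in> carrier (Hp p n e)" "y \<in> carrier (Hp p n e)"
    then obtain h h' where h: "h \<in> carrier_vec n" "class_map p n e h = x"
      and h': "h' \<in> carrier_vec n" "class_map p n e h' = y"
      by (meson class_map_surj)
    have "psi p n e A (class_map p n e (h + h')) = class_map p n e (A *\<^sub>v h + A *\<^sub>v h')"
      using A Ac h h' by (simp add: psi_class_map mult_add_distrib_mat_vec)
    then show "psi p n e A (x \<otimes>\<^bsub>Hp p n e\<^esub> y) = psi p n e A x \<otimes>\<^bsub>Hp p n e\<^esub> psi p n e A y"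
      using A Ac h h' psi_class_map[OF A] by (auto simp: class_map_add)
  qed
  then show ?thesis
    by (simp add: End_ring_def psi_extensional)
qed

text \<open>By \<open>eq_psiI\<close> each law becomes an identity for matrices acting on
  \<open>h\<close>. The extensionality required there follows from closure of the ring operations on
  endomorphisms.\<close>

lemma ring_hom_ring_psi: "ring_hom_ring (Rp p n e) (End_ring (Hp p n e)) (psi p n e)"
proof (rule ring_hom_ringI)
  interpret R: ring "Rp p n e" by (rule ring_Rp)
  interpret E: ring "End_ring (Hp p n e)"
    by (rule ring_End_ring[OF comm_group_Hp])
  show "ring (Rp p n e)" "ring (End_ring (Hp p n e))" by unfold_locales
  show "psi p n e A \<in> carrier (End_ring (Hp p n e))" if "A \<in> carrier (Rp p n e)" for A
    using that by (rule psi_closed)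
  have ext: "f \<in> extensional (carrier (Hp p n e))" if "f \<in> carrier (End_ring (Hp p n e))" for f
    using that by (simp add: End_ring_def)
  show "psi p n e \<one>\<^bsub>Rp p n e\<^esub> = \<one>\<^bsub>End_ring (Hp p n e)\<^esub>"
    by (rule eq_psiI[OF R.one_closed ext[OF E.one_closed]])
      (simp add: End_ring_def Rp_def ring_mat_simps class_map_closed)
  fix A B assume A: "A \<in> carrier (Rp p n e)" and B: "B \<in> carrier (Rp p n e)"
  then have c: "A \<in> carrier_mat n n" "B \<in> carrier_mat n n" by (simp_all add: carrier_Rp)
  note closed = psi_closed[OF A] psi_closed[OF B]
  show "psi p n e (A \<otimes>\<^bsub>Rp p n e\<^esub> B) = psi p n e A \<otimes>\<^bsub>End_ring (Hp p n e)\<^esub> psi p n e B"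
  proof (rule eq_psiI[OF R.m_closed[OF A B] ext[OF E.m_closed[OF closed]]])
    fix h :: "int vec" assume h: "h \<in> carrier_vec n"
    have "A \<otimes>\<^bsub>Rp p n e\<^esub> B = A * B" by (simp add: Rp_def ring_mat_simps)
    with A B c h show "(psi p n e A \<otimes>\<^bsub>End_ring (Hp p n e)\<^esub> psi p n e B) (class_map p n e h)
        = class_map p n e ((A \<otimes>\<^bsub>Rp p n e\<^esub> B) *\<^sub>v h)"
      by (simp add: End_ring_def compose_def class_map_closed psi_class_map)
  qed
  show "psi p n e (A \<oplus>\<^bsub>Rp p n e\<^esub> B) = psi p n e A \<oplus>\<^bsub>End_ring (Hp p n e)\<^esub> psi p n e B"
  proof (rule eq_psiI[OF R.add.m_closed[OF A B] ext[OF E.add.m_closed[OF closed]]])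
    fix h :: "int vec" assume h: "h \<in> carrier_vec n"
    have "A \<oplus>\<^bsub>Rp p n e\<^esub> B = A + B" by (simp add: Rp_def ring_mat_simps)
    with A B c h show "(psi p n e A \<oplus>\<^bsub>End_ring (Hp p n e)\<^esub> psi p n e B) (class_map p n e h)
        = class_map p n e ((A \<oplus>\<^bsub>Rp p n e\<^esub> B) *\<^sub>v h)"
      by (simp add: End_ring_def class_map_closed psi_class_map class_map_add
          add_mult_distrib_mat_vec)
  qed
qed

section \<open>Surjectivity\<close>

lemma psi_surj:
  assumes f: "f \<in> carrier (End_ring (Hp p n e))"
  obtains A where "A \<in> carrier (Rp p n e)" "psi p n e A = f"
proof -
  have f_closed: "f x \<in> carrier (Hp p n e)" if "x \<in> carrier (Hp p n e)" for x
    using f that by (auto simp: End_ring_def hom_def)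
  have f_mult: "f (x \<otimes>\<^bsub>Hp p n e\<^esub> y) = f x \<otimes>\<^bsub>Hp p n e\<^esub> f y"
    if "x \<in> carrier (Hp p n e)" "y \<in> carrier (Hp p n e)" for x y
    using f that by (auto simp: End_ring_def hom_def)
  define \<phi> where "\<phi> i h = f (class_map p n e h) i" for i h
  \<comment> \<open>Column \<open>j\<close> consists of the standard residues of the image under
    \<open>f\<close> of the class of the \<open>j\<close>-th unit vector.\<close>
  define A where "A = mat n n (\<lambda>(i, j). \<phi> i (unit_vec n j))"
  have Ac: "A \<in> carrier_mat n n" by (simp add: A_def)
  have add: "int (p ^ e i) dvd \<phi> i (h + h') - (\<phi> i h + \<phi> i h')"
    if "i < n" "h \<in> carrier_vec n" "h' \<in> carrier_vec n" for i h h'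
  proof -
    have "\<phi> i (h + h') = (\<phi> i h + \<phi> i h') mod int (p ^ e i)"
      using that
      by (simp only: \<phi>_def class_map_add f_mult class_map_closed) (simp add: mult_Hp)
    then show ?thesis by (simp flip: mod_eq_dvd_iff)
  qed
  have lin: "int (p ^ e i) dvd \<phi> i h - (A *\<^sub>v h) $ i" if i: "i < n" and h: "h \<in> carrier_vec n" for i h
  proof -
    have "(A *\<^sub>v h) $ i = (\<Sum>j<n. \<phi> i (unit_vec n j) * h $ j)"
      unfolding mat_vec_index_sum[OF Ac h i] using i by (intro sum.cong) (auto simp: A_def)
    with additive_mod_unit_vec[of n "int (p ^ e i)" "\<phi> i", OF add[OF i] h] show ?thesis by simp
  qed
  have "int (p ^ (e i - e j)) dvd A $$ (i, j)" if i: "i < n" and j: "j < n" for i j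
  \<comment> \<open>If \<open>e i < e j\<close>, the truncated difference is 0 and the divisor is
    1.\<close>
  proof (cases "e j \<le> e i")
    case True
    \<comment> \<open>This vector has trivial class, so \<open>\<phi> i\<close> is 0 modulo
      \<open>p ^ e i\<close> on it, while \<open>A\<close> maps it to \<open>p ^ e j\<close> times
      column \<open>j\<close>. Cancelling the nonzero factor \<open>p ^ e j\<close> then leaves the
      required divisibility.\<close>
    let ?h = "int (p ^ e j) \<cdot>\<^sub>v unit_vec n j"
    have "class_map p n e ?h = class_map p n e (0\<^sub>v n)"
      using j by (auto simp: class_map_eq_iff unit_vec_def)
    then have "\<phi> i ?h = \<phi> i (0\<^sub>v n)" by (simp add: \<phi>_def)
    moreover have "int (p ^ e i) dvd \<phi> i (0\<^sub>v n)"
      using add[OF i, of "0\<^sub>v n" "0\<^sub>v n"] by simp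
    moreover have "(A *\<^sub>v ?h) $ i = int (p ^ e j) * A $$ (i, j)"
      using i j Ac by (simp add: mult.commute)
    ultimately have "int (p ^ e i) dvd int (p ^ e j) * A $$ (i, j)"
      using lin[OF i, of ?h] by (metis dvd_diff_right_iff smult_carrier_vec unit_vec_carrier dvd_diff_commute)
    moreover have "int (p ^ e i) = int (p ^ e j) * int (p ^ (e i - e j))"
      using True by (simp flip: power_add)
    ultimately show ?thesis using p_pos by simp
  qed simp
  then have A: "A \<in> carrier (Rp p n e)" by (simp add: carrier_Rp Ac)
  moreover have "psi p n e A = f"
  proof (rule eq_psiI[OF A])
    show "f \<in> extensional (carrier (Hp p n e))" using f by (simp add: End_ring_def)
    fix h :: "int vec" assume h: "h \<in> carrier_vec n"
    \<comment> \<open>Writing the value of \<open>f\<close> as a class turns the desired equality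
      into the coordinatewise divisibilities of \<open>class_map_eq_iff\<close>, which
      \<open>lin\<close> provides.\<close>
    obtain h' where h': "h' \<in> carrier_vec n" "class_map p n e h' = f (class_map p n e h)"
      by (rule class_map_surj[OF f_closed[OF class_map_closed]])
    have "int (p ^ e i) dvd h' $ i - (A *\<^sub>v h) $ i" if i: "i < n" for i
    proof -
      have "\<phi> i h = h' $ i mod int (p ^ e i)"
        using i unfolding \<phi>_def h'(2)[symmetric] by (simp add: class_map_def)
      then have "h' $ i mod int (p ^ e i) = \<phi> i h mod int (p ^ e i)" by simp
      also have "\<dots> = (A *\<^sub>v h) $ i mod int (p ^ e i)"
        using lin[OF i h] by (simp only: mod_eq_dvd_iff)
      finally show ?thesis by (simp only: mod_eq_dvd_iff)
    qed
    then show "f (class_map p n e h) = class_map p n e (A *\<^sub>v h)"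
      unfolding h'(2)[symmetric] class_map_eq_iff by blast
  qed
  ultimately show ?thesis by (rule that)
qed

end

theorem theorem3p3:
  fixes p n :: nat and e :: "nat \<Rightarrow> nat"
  assumes "Factorial_Ring.prime p"
    and "1 \<le> n"
    and "\<And>i. i < n \<Longrightarrow> 1 \<le> e i"
    and "\<And>i j. i \<le> j \<Longrightarrow> j < n \<Longrightarrow> e i \<le> e j"
  shows
    "(\<forall>A \<in> carrier (Rp p n e). \<forall>h \<in> carrier_vec n. \<forall>h' \<in> carrier_vec n.
        class_map p n e h = class_map p n e h' \<longrightarrow>
        class_map p n e (A *\<^sub>v h) = class_map p n e (A *\<^sub>v h'))
     \<and> (\<forall>A \<in> carrier (Rp p n e). \<forall>x \<in> carrier (Hp p n e).
        (\<exists>h \<in> carrier_vec n. class_map p n e h = x) \<and>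
        (\<forall>h \<in> carrier_vec n. class_map p n e h = x \<longrightarrow>
           psi p n e A x = class_map p n e (A *\<^sub>v h)))
     \<and> ring_hom_ring (Rp p n e) (End_ring (Hp p n e)) (psi p n e)
     \<and> psi p n e ` carrier (Rp p n e) = carrier (End_ring (Hp p n e))"
proof -
  interpret exponents p n e
    using assms by unfold_locales (auto simp: prime_gt_0_nat)
  have "psi p n e ` carrier (Rp p n e) = carrier (End_ring (Hp p n e))"
    using psi_closed by (auto elim: psi_surj)
  moreover have "\<exists>h \<in> carrier_vec n. class_map p n e h = x" if "x \<in> carrier (Hp p n e)" for x
    using class_map_surj[OF that] by blast
  ultimately show ?thesis
    using class_map_mult_mat_vec_cong psi_class_map ring_hom_ring_psi by blast
qed

end
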